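(* Let $A,B\subset\mathbb{R}^n$, and let $x\in\overline A\cap\overline B$. Then \[ \mathrm{Eff}_x^{\mathbb P}(A\cup B)=\mathrm{Eff}_x^{\mathbb P}(A)\cup\mathrm{Eff}_x^{\mathbb P}(B), \] and, for every $\xi\in\mathbb{P}^{n-1}$, \[ \widehat{\theta}_x^{A\cup B}(\xi)=\max\left\{\widehat{\theta}_x^A(\xi),\widehat{\theta}_x^B(\xi)\right\}. \] Equivalently, using the preceding weight identity in the definition of $\dim_\times$, one has \[ \dim_{\times}\{x\}_{A\cup B}=\sup_{(\xi_1,\dots,\xi_m)\in\mathcal I_x^{\mathbb P}(A\cup B)}\ \sum_{i=1}^m\max\left\{\widehat{\theta}_x^A(\xi_i),\widehat{\theta}_x^B(\xi_i)\right\}. \]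
   Context: Tangent cone: for $A\subset\mathbb{R}^n$, $\mathrm{Tan}_x(A)$ is the set of $v\in\mathbb{R}^n$ for which there exist $x_k\in A$, $x_k\to x$, and positive reals $\lambda_k\downarrow0$ with $(x_k-x)/\lambda_k\to v$. Effective directions: $\mathrm{Eff}_x(A):=\mathrm{Tan}_x(A)\cap S^{n-1}$ if $x\in\overline A$ (and $\varnothing$ otherwise). For $v\ne0$ let $[v]=\mathbb{R}v\in\mathbb{P}^{n-1}$; $\mathrm{Eff}_x^{\mathbb P}(A):=\{[v]:v\in\mathrm{Eff}_x(A)\}$. Admissible probes: for $x\in\overline A$, $v\in S^{n-1}$, $\mathcal G_x^A(v)$ is the family of all injective Lipschitz maps $\gamma:[0,\delta]\to\mathbb{R}^n$ (some $\delta>0$) with $\gamma(0)=x$, $\lim_{t\to0^+}\frac{\gamma(t)-x}{\|\gamma(t)-x\|}=v$, and $A\cap\gamma((0,\eta])\ne\varnothing$ for every $\eta\in(0,\delta]$; $\Gamma_\gamma:=\gamma([0,\delta])$. Point-extended box dimension: for bounded $E$, $N_\varepsilon(E)$ is the minimal number of sets of diameter at most $\varepsilon$ covering $E$ and $\overline{\dim}_B(E):=\limsup_{\varepsilon\to0}\frac{\ln N_\varepsilon(E)}{\ln(1/\varepsilon)}$. For $x\in\overline E$, $\dim_{\mathrm{Pbox}}\{x\}_E:=\inf_{r>0}\overline{\dim}_B(E\cap B(x,r))$; it is $0$ if $x\notin\overline E$. Directional contribution: for $v\in\mathrm{Eff}_x(A)$, $\theta_x^A(v):=\sup_{\gamma\in\mathcal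 G_x^A(v)}\dim_{\mathrm{Pbox}}\{x\}_{A\cap\Gamma_\gamma}$; for $\xi\in\mathrm{Eff}_x^{\mathbb P}(A)$, $\theta_x^A(\xi):=\sup\{\theta_x^A(w):w\in\mathrm{Eff}_x(A),[w]=\xi\}$. Extension by zero: for $v\in S^{n-1}$, $\widehat\theta_x^E(v):=\theta_x^E(v)$ if $v\in\mathrm{Eff}_x(E)$ and $\widehat\theta_x^E(v):=0$ otherwise; for $\xi\in\mathbb{P}^{n-1}$, $\widehat\theta_x^E(\xi):=\sup\{\widehat\theta_x^E(v):v\in S^{n-1},[v]=\xi\}$. Thus $\widehat\theta_x^E(\xi)=\theta_x^E(\xi)$ when $\xi\in\mathrm{Eff}_x^{\mathbb P}(E)$ and $0$ otherwise. $\mathcal I_x^{\mathbb P}(A)$ is the set of families $(\xi_1,\dots,\xi_m)$, $m\in\{0,\dots,n\}$, of projectively (linearly) independent elements of $\mathrm{Eff}_x^{\mathbb P}(A)$, i.e. with linearly independent nonzero representatives (the empty family is included). Point-Cross dimension at $x\in\overline A$: $\dim_\times\{x\}_A:=\sup_{(\xi_1,\dots,\xi_m)\in\mathcal I_x^{\mathbb P}(A)}\sum_{i=1}^m\theta_x^A(\xi_i)$, with empty sum $0$. *)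

theory Defs
  imports "HOL-Analysis.Analysis"
begin

definition tangent_cone :: "real^'n \<Rightarrow> (real^'n) set \<Rightarrow> (real^'n) set" where
  "tangent_cone x A = {v. \<exists>(y :: nat \<Rightarrow> real^'n) (l :: nat \<Rightarrow> real).
      (\<forall>k. y k \<in> A) \<and> y \<longlonglongrightarrow> x \<and>
      (\<forall>k. l k > 0) \<and> decseq l \<and> l \<longlonglongrightarrow> 0 \<and>
      (\<lambda>k. (y k - x) /\<^sub>R l k) \<longlonglongrightarrow> v}"

definition eff_dirs :: "real^'n \<Rightarrow> (real^'n) set \<Rightarrow> (real^'n) set" where
  "eff_dirs x A = (if x \<in> closure A then tangent_cone x A \<inter> sphere 0 1 else {})"

text \<open>A point of projective space is encoded as the line through the origin that it
  denotes, a set of vectors.\<close>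

definition proj_class :: "real^'n \<Rightarrow> (real^'n) set" where
  "proj_class v = span {v}"

definition proj_space :: "(real^'n) set set" where
  "proj_space = {proj_class v |v. v \<noteq> 0}"

definition proj_eff_dirs :: "real^'n \<Rightarrow> (real^'n) set \<Rightarrow> (real^'n) set set" where
  "proj_eff_dirs x A = proj_class ` eff_dirs x A"

text \<open>A probe is a pair of its parameter length and a map; only the restriction of the
  map to \<open>{0..d}\<close> is relevant.\<close>

definition probes ::
  "real^'n \<Rightarrow> (real^'n) set \<Rightarrow> real^'n \<Rightarrow> (real \<times> (real \<Rightarrow> real^'n)) set" where
  "probes x A v = {(d, g). d > 0 \<and> inj_on g {0..d} \<and> (\<exists>L. L-lipschitz_on {0..d} g) \<and>
      g 0 = x \<and>
      ((\<lambda>t. (g t - x) /\<^sub>R norm (g t - x)) \<longlongrightarrow> v) (at_right 0) \<and>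
      (\<forall>e\<in>{0<..d}. A \<inter> g ` {0<..e} \<noteq> {})}"

text \<open>The condition \<open>bounded U\<close> is needed because \<open>diameter\<close> is not meaningful on
  unbounded sets.\<close>

definition covering_number :: "real \<Rightarrow> (real^'n) set \<Rightarrow> nat" where
  "covering_number e E = (LEAST k. \<exists>F. finite F \<and> card F = k \<and> E \<subseteq> \<Union>F \<and>
      (\<forall>U\<in>F. bounded U \<and> diameter U \<le> e))"

text \<open>All dimensions take values in \<open>[0, \<infinity>]\<close>, so that suprema always exist and a supremum
  over an empty family is 0. For bounded \<open>E\<close> and \<open>0 < e < 1\<close> the quotient below is
  nonnegative, so the embedding \<open>ennreal\<close> does not alter it; the empty set gets dimension 0
  because \<open>ln 0 = 0\<close>.\<close>

definition upper_box_dim :: "(real^'n) set \<Rightarrow> ennreal" where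
  "upper_box_dim E =
     Limsup (at_right 0) (\<lambda>e. ennreal (ln (real (covering_number e E)) / ln (1 / e)))"

definition pbox_dim :: "real^'n \<Rightarrow> (real^'n) set \<Rightarrow> ennreal" where
  "pbox_dim x E =
     (if x \<in> closure E then (INF r\<in>{0<..}. upper_box_dim (E \<inter> ball x r)) else 0)"

definition theta :: "real^'n \<Rightarrow> (real^'n) set \<Rightarrow> real^'n \<Rightarrow> ennreal" where
  "theta x A v = (SUP (d, g)\<in>probes x A v. pbox_dim x (A \<inter> g ` {0..d}))"

definition proj_theta :: "real^'n \<Rightarrow> (real^'n) set \<Rightarrow> (real^'n) set \<Rightarrow> ennreal" where
  "proj_theta x A \<xi> = (SUP w\<in>{w \<in> eff_dirs x A. proj_class w = \<xi>}. theta x A w)"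

definition theta_hat :: "real^'n \<Rightarrow> (real^'n) set \<Rightarrow> real^'n \<Rightarrow> ennreal" where
  "theta_hat x E v = (if v \<in> eff_dirs x E then theta x E v else 0)"

definition proj_theta_hat :: "real^'n \<Rightarrow> (real^'n) set \<Rightarrow> (real^'n) set \<Rightarrow> ennreal" where
  "proj_theta_hat x E \<xi> = (SUP v\<in>{v \<in> sphere 0 1. proj_class v = \<xi>}. theta_hat x E v)"

text \<open>Families are lists, and the empty list is included. Linear independence of a family
  of representatives means that they are pairwise distinct and form an independent set.\<close>

definition indep_families :: "real^'n \<Rightarrow> (real^'n) set \<Rightarrow> (real^'n) set list set" where
  "indep_families x A = {\<xi>s. length \<xi>s \<le> CARD('n) \<and> set \<xi>s \<subseteq> proj_eff_dirs x A \<and>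
      (\<exists>vs. map proj_class vs = \<xi>s \<and> 0 \<notin> set vs \<and> distinct vs \<and> independent (set vs))}"

definition cross_dim :: "real^'n \<Rightarrow> (real^'n) set \<Rightarrow> ennreal" where
  "cross_dim x A =
     (SUP \<xi>s\<in>indep_families x A. \<Sum>i<length \<xi>s. proj_theta x A (\<xi>s ! i))"

end

theory Submission imports Defs "HOL-Real_Asymp.Real_Asymp" begin

text \<open>Passing to a subsequence, a tangent direction of \<open>A \<union> B\<close> is one of \<open>A\<close> or of \<open>B\<close>. For the
  weights, let \<open>\<gamma>\<close> be a probe for \<open>A \<union> B\<close>. By finite stability of the box dimension, its
  contribution is the larger of those of \<open>A \<inter> \<Gamma>\<^sub>\<gamma>\<close> and \<open>B \<inter> \<Gamma>\<^sub>\<gamma>\<close>. If \<open>A\<close> meets every initial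
  piece of \<open>\<gamma>\<close>, then \<open>\<gamma>\<close> is also a probe for \<open>A\<close> and its direction is effective for \<open>A\<close>;
  otherwise, \<open>\<gamma>\<close> being injective, \<open>A \<inter> \<Gamma>\<^sub>\<gamma>\<close> is at most \<open>{x}\<close> near \<open>x\<close> and contributes \<open>0\<close>.\<close>

section \<open>Box dimension\<close>

definition covers_by :: "real \<Rightarrow> (real^'n) set \<Rightarrow> (real^'n) set set \<Rightarrow> bool" where
  "covers_by e E F \<longleftrightarrow> finite F \<and> E \<subseteq> \<Union>F \<and> (\<forall>U\<in>F. bounded U \<and> diameter U \<le> e)"

lemma covering_number_le:
  assumes "covers_by e E F"
  shows "covering_number e E \<le> card F"
  unfolding covering_number_def
  by (rule Least_le) (use assms in \<open>auto simp: covers_by_def\<close>)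

text \<open>The closure is compact, hence totally bounded, and balls of radius e/2 have diameter at
  most e. This existence is what makes the \<open>LEAST\<close> in \<open>covering_number\<close> a
  true minimum.\<close>

lemma covers_by_exists:
  assumes "bounded E" "e > 0"
  shows "\<exists>F. covers_by e E F"
proof -
  have "compact (closure E)" using assms by simp
  then obtain k where k: "finite k" "closure E \<subseteq> (\<Union>x\<in>k. ball x (e/2))"
    using assms(2) unfolding compact_eq_totally_bounded by (meson half_gt_zero)
  have "covers_by e E ((\<lambda>x. ball x (e/2)) ` k)"
    unfolding covers_by_def using k closure_subset[of E] assms(2) by auto
  then show ?thesis by blast
qed

lemma covers_by_card_covering_number:
  assumes "bounded E" "e > 0"
  obtains F where "covers_by e E F" "card F = covering_number e E"
proof -
  have "\<exists>F. finite F \<and> card F = covering_number e E \<and> E \<subseteq> \<Union>F \<and>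
      (\<forall>U\<in>F. bounded U \<and> diameter U \<le> e)"
    unfolding covering_number_def
    by (rule LeastI_ex) (use covers_by_exists[OF assms] in \<open>auto simp: covers_by_def\<close>)
  then show ?thesis using that by (auto simp: covers_by_def)
qed

lemma covering_number_mono:
  assumes "E \<subseteq> E'" "bounded E'" "e > 0"
  shows "covering_number e E \<le> covering_number e E'"
proof -
  obtain F where F: "covers_by e E' F" "card F = covering_number e E'"
    using covers_by_card_covering_number assms by blast
  then have "covers_by e E F" using assms(1) by (auto simp: covers_by_def)
  then show ?thesis using covering_number_le F(2) by metis
qed

lemma covering_number_Un_le:
  assumes "bounded E" "bounded E'" "e > 0"
  shows "covering_number e (E \<union> E') \<le> covering_number e E + covering_number e E'"
proof -
  obtain F where F: "covers_by e E F" "card F = covering_number e E"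
    using covers_by_card_covering_number assms by blast
  obtain F' where F': "covers_by e E' F'" "card F' = covering_number e E'"
    using covers_by_card_covering_number assms by blast
  have "covers_by e (E \<union> E') (F \<union> F')" using F F' by (auto simp: covers_by_def)
  then have "covering_number e (E \<union> E') \<le> card (F \<union> F')" by (rule covering_number_le)
  also have "\<dots> \<le> card F + card F'" by (rule card_Un_le)
  finally show ?thesis using F F' by simp
qed

text \<open>The case m = 0 is covered by the convention \<open>ln 0 = 0\<close>, since logarithms of
  positive integers are nonnegative.\<close>

lemma ln_of_nat_mono: "m \<le> n \<Longrightarrow> ln (real m) \<le> ln (real n)"
  by (cases "m = 0"; cases "n = 0") auto

section \<open>Upper box dimension: monotonicity and finite stability\<close>

lemma eventually_less_1_at_right_0: "eventually (\<lambda>e::real. 0 < e \<and> e < 1) (at_right 0)"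
  by (rule eventually_at_rightI[of 0 1]) auto

lemma upper_box_dim_mono:
  assumes "E \<subseteq> E'" "bounded E'"
  shows "upper_box_dim E \<le> upper_box_dim E'"
  unfolding upper_box_dim_def
proof (rule Limsup_mono, rule eventually_mono[OF eventually_less_1_at_right_0])
  fix e :: real assume e: "0 < e \<and> e < 1"
  show "ennreal (ln (real (covering_number e E)) / ln (1 / e))
      \<le> ennreal (ln (real (covering_number e E')) / ln (1 / e))"
    using e by (intro ennreal_leI divide_right_mono ln_of_nat_mono covering_number_mono assms) auto
qed

lemma upper_box_dim_subset_singleton:
  assumes "E \<subseteq> {x}"
  shows "upper_box_dim E = 0"
proof -
  have "ennreal (ln (real (covering_number e E)) / ln (1 / e)) \<le> 0" if "0 < e \<and> e < 1" for e
  proof -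
    have "covers_by e E {{x}}" using assms that by (auto simp: covers_by_def)
    then have "covering_number e E \<le> 1" using covering_number_le by fastforce
    \<comment> \<open>The covering number is 0 or 1, and \<open>ln\<close> vanishes at both.\<close>
    then have "ln (real (covering_number e E)) = 0"
      by (metis le_antisym less_one ln_0 ln_one not_le of_nat_0 of_nat_1)
    then show ?thesis by simp
  qed
  then have "upper_box_dim E \<le> 0"
    unfolding upper_box_dim_def
    by (intro Limsup_bounded eventually_mono[OF eventually_less_1_at_right_0])
  then show ?thesis by simp
qed

text \<open>The covering number of the union is at most twice the larger one. The factor 2 adds only
  ln 2 / ln (1/e) to the quotient, which tends to 0 with e.\<close>

lemma upper_box_dim_Un_le:
  assumes "bounded E" "bounded E'"
  shows "upper_box_dim (E \<union> E') \<le> max (upper_box_dim E) (upper_box_dim E')"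
proof -
  let ?q = "\<lambda>E e. ln (real (covering_number e E)) / ln (1 / e)"
  have bound: "ennreal (?q (E \<union> E') e)
      \<le> max (ennreal (?q E e)) (ennreal (?q E' e)) + ennreal (ln 2 / ln (1 / e))"
    if e: "0 < e" "e < 1" for e
  proof -
    define m where "m = max (covering_number e E) (covering_number e E')"
    have pos: "ln (1 / e) > 0" using e by simp
    have "covering_number e (E \<union> E') \<le> 2 * m"
      using covering_number_Un_le[OF assms e(1)] by (simp add: m_def)
    then have "ln (real (covering_number e (E \<union> E'))) \<le> ln (real (2 * m))"
      by (rule ln_of_nat_mono)
    \<comment> \<open>Equality fails for m = 0, when both sets are empty: the left side is then 0
      and the right side ln 2.\<close>
    also have "\<dots> \<le> ln (real m) + ln 2" by (cases "m = 0") (simp_all add: ln_mult)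
    finally have le: "?q (E \<union> E') e \<le> ln (real m) / ln (1 / e) + ln 2 / ln (1 / e)"
      using pos by (metis add_divide_distrib divide_right_mono less_imp_le)
    \<comment> \<open>Nonnegativity lets \<open>ennreal\<close> be split over the sum in
      \<open>le\<close>.\<close>
    have nonneg: "ln (real k) / ln (1 / e) \<ge> 0" for k
      using pos ln_of_nat_mono[of 0 k] by simp
    have "ennreal (?q (E \<union> E') e)
        \<le> ennreal (ln (real m) / ln (1 / e)) + ennreal (ln 2 / ln (1 / e))"
      using ennreal_leI[OF le] nonneg[of m] pos by (simp add: ennreal_plus)
    also have "ennreal (ln (real m) / ln (1 / e)) \<le> max (ennreal (?q E e)) (ennreal (?q E' e))"
      by (cases "covering_number e E \<le> covering_number e E'") (auto simp: m_def max_def)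
    finally show ?thesis by (simp add: add_right_mono)
  qed
  have lim: "((\<lambda>e. ennreal (ln 2 / ln (1 / e))) \<longlongrightarrow> 0) (at_right 0)"
  proof -
    have "((\<lambda>e::real. ln 2 / ln (1 / e)) \<longlongrightarrow> 0) (at_right 0)" by real_asymp
    then show ?thesis using tendsto_ennrealI by fastforce
  qed
  show ?thesis
    unfolding upper_box_dim_def
  proof (subst Limsup_le_iff, intro allI impI)
    fix y assume "max (Limsup (at_right 0) (\<lambda>e. ennreal (?q E e)))
        (Limsup (at_right 0) (\<lambda>e. ennreal (?q E' e))) < y"
    \<comment> \<open>The gap between z and y leaves room for the vanishing error term.\<close>
    then obtain z where "max (Limsup (at_right 0) (\<lambda>e. ennreal (?q E e)))
        (Limsup (at_right 0) (\<lambda>e. ennreal (?q E' e))) < z" "z < y"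
      using dense by blast
    then have z: "Limsup (at_right 0) (\<lambda>e. ennreal (?q E e)) < z"
        "Limsup (at_right 0) (\<lambda>e. ennreal (?q E' e)) < z" "z < y"
      by simp_all
    have "((\<lambda>e. z + ennreal (ln 2 / ln (1 / e))) \<longlongrightarrow> z + 0) (at_right 0)"
      by (intro tendsto_add tendsto_const lim)
    then have "eventually (\<lambda>e. z + ennreal (ln 2 / ln (1 / e)) < y) (at_right 0)"
      using z(3) by (intro order_tendstoD(2)) auto
    with Limsup_lessD[OF z(1)] Limsup_lessD[OF z(2)] eventually_less_1_at_right_0
    show "eventually (\<lambda>e. ennreal (?q (E \<union> E') e) < y) (at_right 0)"
    proof eventually_elim
      case (elim e)
      have "ennreal (?q (E \<union> E') e)
          \<le> max (ennreal (?q E e)) (ennreal (?q E' e)) + ennreal (ln 2 / ln (1 / e))"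
        using bound elim by blast
      also have "\<dots> \<le> z + ennreal (ln 2 / ln (1 / e))"
        using elim by (intro add_right_mono) auto
      also have "\<dots> < y" using elim by blast
      finally show ?case .
    qed
  qed
qed

section \<open>Point-extended box dimension\<close>

lemma pbox_dim_le: "r > 0 \<Longrightarrow> pbox_dim x E \<le> upper_box_dim (E \<inter> ball x r)"
  unfolding pbox_dim_def by (auto intro: INF_lower)

text \<open>Away from the closure some ball around x misses E, so the infimum is already 0 and the
  case distinction in the definition disappears.\<close>

lemma pbox_dim_eq_INF: "pbox_dim x E = (INF r\<in>{0<..}. upper_box_dim (E \<inter> ball x r))"
proof (cases "x \<in> closure E")
  case False
  then obtain r where r: "r > 0" "E \<inter> ball x r = {}"
    by (auto simp: closure_approachable dist_commute disjoint_iff not_less)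
  then have "(INF r\<in>{0<..}. upper_box_dim (E \<inter> ball x r)) \<le> upper_box_dim (E \<inter> ball x r)"
    by (intro INF_lower) auto
  with r False show ?thesis
    by (simp add: pbox_dim_def upper_box_dim_subset_singleton)
qed (simp add: pbox_dim_def)

lemma pbox_dim_mono:
  assumes "E \<subseteq> E'"
  shows "pbox_dim x E \<le> pbox_dim x E'"
  unfolding pbox_dim_eq_INF
  by (rule INF_mono') (use assms in \<open>auto intro!: upper_box_dim_mono\<close>)

lemma pbox_dim_subset_singleton:
  assumes "r > 0" "E \<inter> ball x r \<subseteq> {x}"
  shows "pbox_dim x E = 0"
  using pbox_dim_le[OF assms(1), of x E] upper_box_dim_subset_singleton[OF assms(2)] by simp

text \<open>For y above both dimensions, each set has a radius at which its box dimension is below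
  y. Finite stability is applied at the smaller radius.\<close>

lemma pbox_dim_Un_le: "pbox_dim x (E \<union> E') \<le> max (pbox_dim x E) (pbox_dim x E')"
proof (rule dense_ge)
  fix y assume y: "max (pbox_dim x E) (pbox_dim x E') < y"
  then obtain r where r: "r > 0" "upper_box_dim (E \<inter> ball x r) < y"
    by (auto simp: pbox_dim_eq_INF INF_less_iff)
  from y obtain s where s: "s > 0" "upper_box_dim (E' \<inter> ball x s) < y"
    by (auto simp: pbox_dim_eq_INF INF_less_iff)
  let ?t = "min r s"
  have "pbox_dim x (E \<union> E') \<le> upper_box_dim ((E \<inter> ball x ?t) \<union> (E' \<inter> ball x ?t))"
    using pbox_dim_le[of ?t x "E \<union> E'"] r s by (simp add: Int_Un_distrib2)
  also have "\<dots> \<le> max (upper_box_dim (E \<inter> ball x ?t)) (upper_box_dim (E' \<inter> ball x ?t))"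
    by (rule upper_box_dim_Un_le) auto
  also have "\<dots> \<le> max (upper_box_dim (E \<inter> ball x r)) (upper_box_dim (E' \<inter> ball x s))"
    by (intro max.mono upper_box_dim_mono) auto
  also have "\<dots> \<le> y" using r s by (simp add: less_imp_le)
  finally show "pbox_dim x (E \<union> E') \<le> y" .
qed

section \<open>Effective directions\<close>

lemma tangent_cone_mono: "A \<subseteq> B \<Longrightarrow> tangent_cone x A \<subseteq> tangent_cone x B"
  unfolding tangent_cone_def by blast

text \<open>Restricting to the indices with \<open>y k\<close> in A preserves the limits and the
  monotonicity of the scales.\<close>

lemma tangent_cone_subsequence:
  assumes "y \<longlonglongrightarrow> x" "\<And>k. l k > 0" "decseq l" "l \<longlonglongrightarrow> 0"
    and "(\<lambda>k. (y k - x) /\<^sub>R l k) \<longlonglongrightarrow> v" and "infinite {k. y k \<in> A}"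
  shows "v \<in> tangent_cone x A"
proof -
  obtain s :: "nat \<Rightarrow> nat" where s: "strict_mono s" "\<And>k. y (s k) \<in> A"
    using infinite_enumerate[OF assms(6)] by auto
  have "decseq (l \<circ> s)"
    using assms(3) s(1) by (simp add: decseq_def strict_mono_less_eq)
  moreover have "(y \<circ> s) \<longlonglongrightarrow> x" "(l \<circ> s) \<longlonglongrightarrow> 0"
      "((\<lambda>k. (y k - x) /\<^sub>R l k) \<circ> s) \<longlonglongrightarrow> v"
    using assms s(1) by (simp_all add: LIMSEQ_subseq_LIMSEQ)
  ultimately show ?thesis
    unfolding tangent_cone_def using s(2) assms(2)
    by (intro CollectI exI[of _ "y \<circ> s"] exI[of _ "l \<circ> s"]) (auto simp: comp_def)
qed

lemma tangent_cone_Un: "tangent_cone x (A \<union> B) = tangent_cone x A \<union> tangent_cone x B"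
proof
  show "tangent_cone x (A \<union> B) \<subseteq> tangent_cone x A \<union> tangent_cone x B"
  proof
    fix v assume "v \<in> tangent_cone x (A \<union> B)"
    then obtain y l where yl: "\<And>k. y k \<in> A \<union> B" "y \<longlonglongrightarrow> x" "\<And>k. l k > 0"
        "decseq l" "l \<longlonglongrightarrow> 0" "(\<lambda>k. (y k - x) /\<^sub>R l k) \<longlonglongrightarrow> v"
      unfolding tangent_cone_def by blast
    have "{k. y k \<in> A} \<union> {k. y k \<in> B} = UNIV" using yl(1) by blast
    then have "infinite {k. y k \<in> A} \<or> infinite {k. y k \<in> B}"
      by (metis finite_UnI infinite_UNIV_nat)
    then show "v \<in> tangent_cone x A \<union> tangent_cone x B"
      using tangent_cone_subsequence[OF yl(2-6)] by blast
  qed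
qed (simp add: tangent_cone_mono)

lemma eff_dirs_mono:
  assumes "A \<subseteq> B"
  shows "eff_dirs x A \<subseteq> eff_dirs x B"
  using tangent_cone_mono[OF assms] closure_mono[OF assms] by (auto simp: eff_dirs_def)

lemma eff_dirs_Un:
  assumes "x \<in> closure A \<inter> closure B"
  shows "eff_dirs x (A \<union> B) = eff_dirs x A \<union> eff_dirs x B"
  using assms by (auto simp: eff_dirs_def tangent_cone_Un)

text \<open>Points of A on the probe tend to x, and their own distances to x serve as the scales in
  the tangent cone. The difference quotients are then the normalised secants, which tend to
  v.\<close>

lemma probe_direction_in_eff_dirs:
  assumes "(d, g) \<in> probes x A v" "v \<in> sphere 0 1"
  shows "v \<in> eff_dirs x A"
proof -
  have d: "d > 0" and inj: "inj_on g {0..d}" and g0: "g 0 = x"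
    and lim: "((\<lambda>t. (g t - x) /\<^sub>R norm (g t - x)) \<longlongrightarrow> v) (at_right 0)"
    and meets: "\<And>e. 0 < e \<Longrightarrow> e \<le> d \<Longrightarrow> A \<inter> g ` {0<..e} \<noteq> {}"
    using assms(1) by (auto simp: probes_def)
  have "continuous_on {0..d} g"
    using assms(1) by (auto simp: probes_def intro: lipschitz_on_continuous_on)
  then have cont: "(g \<longlongrightarrow> x) (at_right 0)"
    using d g0 by (metis atLeastAtMost_iff at_within_Icc_at_right continuous_on less_eq_real_def)
  \<comment> \<open>Injectivity makes the scales \<open>norm (g t - x)\<close> strictly
    positive.\<close>
  have ne: "g t \<noteq> x" if "0 < t" "t \<le> d" for t
    using inj_onD[OF inj, of t 0] that g0 by auto
  have near: "\<exists>t. 0 < t \<and> t \<le> d \<and> t < e \<and> g t \<in> A \<and> norm (g t - x) < e" if "e > 0" for e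
  proof -
    have "eventually (\<lambda>t. dist (g t) x < e) (at_right 0)" using cont that by (rule tendstoD)
    then obtain b where b: "b > 0" "\<And>t. 0 < t \<Longrightarrow> t < b \<Longrightarrow> dist (g t) x < e"
      by (auto simp: eventually_at_right_field)
    \<comment> \<open>Halving gives the strict bounds by b and e; the cap d keeps c an admissible
      parameter for \<open>meets\<close>.\<close>
    define c where "c = min (min b e / 2) d"
    have c: "0 < c" "c < b" "c < e" "c \<le> d" using b d that by (auto simp: c_def min_def)
    obtain t where "t \<in> {0<..c}" "g t \<in> A" using meets[OF c(1,4)] by blast
    then show ?thesis using b(2)[of t] c by (intro exI[of _ t]) (auto simp: dist_norm)
  qed
  text \<open>The radii must decrease for the definition of the tangent cone, so each parameter is
    chosen to bring the probe closer to its base point than the previous one.\<close>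
  let ?P = "\<lambda>n t. 0 < t \<and> t \<le> d \<and> t < 1 / real (Suc n) \<and> g t \<in> A \<and>
    norm (g t - x) < 1 / real (Suc n)"
  obtain t where t: "\<And>n. ?P n (t n)" "\<And>n. norm (g (t (Suc n)) - x) \<le> norm (g (t n) - x)"
  proof -
    have "\<exists>u. ?P (Suc n) u \<and> norm (g u - x) \<le> norm (g t - x)" if "?P n t" for n t
    proof -
      have "norm (g t - x) > 0" using ne that by simp
      \<comment> \<open>A single use of \<open>near\<close> with this radius yields both the bound
        for the next index and the decrease of the distance.\<close>
      then have "min (1 / real (Suc (Suc n))) (norm (g t - x)) > 0" by simp
      from near[OF this] show ?thesis by auto
    qed
    moreover have "\<exists>t. ?P 0 t" using near[of 1] by auto
    ultimately show ?thesis
      using dependent_nat_choice[of ?P "\<lambda>_ t u. norm (g u - x) \<le> norm (g t - x)"] that by metis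
  qed
  have inv: "(\<lambda>n. 1 / real (Suc n)) \<longlonglongrightarrow> 0" by real_asymp
  have "t \<longlonglongrightarrow> 0"
    using t(1) by (intro tendsto_sandwich[OF _ _ tendsto_const inv] always_eventually)
      (auto intro: less_imp_le)
  then have t0: "filterlim t (at_right 0) sequentially"
    using t(1) by (auto simp: filterlim_at intro!: always_eventually dest: less_imp_neq[symmetric])
  have yx: "(\<lambda>n. g (t n)) \<longlonglongrightarrow> x" using filterlim_compose[OF cont t0] .
  have l0: "(\<lambda>n. norm (g (t n) - x)) \<longlonglongrightarrow> 0"
    using yx by (simp add: LIM_zero tendsto_norm_zero)
  have quot: "(\<lambda>n. (g (t n) - x) /\<^sub>R norm (g (t n) - x)) \<longlonglongrightarrow> v"
    using filterlim_compose[OF lim t0] .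
  have "v \<in> tangent_cone x A"
    by (rule tangent_cone_subsequence[OF yx _ _ l0 quot])
       (use t ne in \<open>auto simp: decseq_Suc_iff\<close>)
  moreover have "x \<in> closure A"
    unfolding closure_sequential using t(1) yx by (intro exI[of _ "\<lambda>n. g (t n)"]) blast
  ultimately show ?thesis using assms(2) by (simp add: eff_dirs_def)
qed

section \<open>Directional weights\<close>

text \<open>Enlarging A preserves the condition that the probe meets the set, and enlarges the trace
  on each probe.\<close>

lemma theta_mono:
  assumes "A \<subseteq> B"
  shows "theta x A v \<le> theta x B v"
  unfolding theta_def
proof (rule SUP_least, clarify)
  fix d g assume "(d, g) \<in> probes x A v"
  then have g: "(d, g) \<in> probes x B v" using assms unfolding probes_def by fast
  have "pbox_dim x (A \<inter> g ` {0..d}) \<le> pbox_dim x (B \<inter> g ` {0..d})"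
    using assms by (intro pbox_dim_mono) auto
  also have "\<dots> \<le> (SUP (d, g)\<in>probes x B v. pbox_dim x (B \<inter> g ` {0..d}))"
    using SUP_upper[OF g, of "\<lambda>(d, g). pbox_dim x (B \<inter> g ` {0..d})"] by simp
  finally show "pbox_dim x (A \<inter> g ` {0..d})
      \<le> (SUP (d, g)\<in>probes x B v. pbox_dim x (B \<inter> g ` {0..d}))" .
qed

lemma theta_hat_mono: "A \<subseteq> B \<Longrightarrow> theta_hat x A v \<le> theta_hat x B v"
  using theta_mono[of A B x v] eff_dirs_mono[of A B x] by (auto simp: theta_hat_def)

text \<open>The probe belongs to some set C, which will be the union. Bounding by
  \<open>theta_hat\<close> allows for v not being effective for A; this can only occur when A misses
  an initial piece of the probe.\<close>

lemma pbox_dim_probe_le_theta_hat: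
  assumes g: "(d, g) \<in> probes x C v" and v: "v \<in> sphere 0 1"
  shows "pbox_dim x (A \<inter> g ` {0..d}) \<le> theta_hat x A v"
proof (cases "\<forall>e\<in>{0<..d}. A \<inter> g ` {0<..e} \<noteq> {}")
  case True
  then have gA: "(d, g) \<in> probes x A v" using g by (auto simp: probes_def)
  then have "theta_hat x A v = theta x A v"
    using probe_direction_in_eff_dirs[OF gA v] by (simp add: theta_hat_def)
  then show ?thesis
    using SUP_upper[OF gA, of "\<lambda>(d, g). pbox_dim x (A \<inter> g ` {0..d})"] by (simp add: theta_def)
next
  case False
  then obtain e where e: "0 < e" "e \<le> d" "A \<inter> g ` {0<..e} = {}" by auto
  have inj: "inj_on g {0..d}" and g0: "g 0 = x" using g by (auto simp: probes_def)
  have "continuous_on {0..d} g"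
    using g by (auto simp: probes_def intro: lipschitz_on_continuous_on)
  then have "continuous_on {e..d} g" using e by (auto elim: continuous_on_subset)
  \<comment> \<open>The rest of the probe is compact and avoids x by injectivity, so it stays a
    positive distance r away.\<close>
  then have "closed (g ` {e..d})" by (simp add: compact_continuous_image compact_imp_closed)
  moreover have "x \<notin> g ` {e..d}"
  proof
    assume "x \<in> g ` {e..d}"
    then obtain t where "t \<in> {e..d}" "g t = g 0" using g0 by auto
    then show False using inj_onD[OF inj, of t 0] e by auto
  qed
  ultimately obtain r where r: "r > 0" "ball x r \<inter> g ` {e..d} = {}"
    by (metis Compl_iff disjoint_eq_subset_Compl open_Compl open_contains_ball)
  \<comment> \<open>Parameters in (0,e] give no points of A and those in [e,d] none of the ball, so
    only parameter 0 remains.\<close>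
  have "A \<inter> g ` {0..d} \<inter> ball x r \<subseteq> {x}"
  proof
    fix z assume z: "z \<in> A \<inter> g ` {0..d} \<inter> ball x r"
    then obtain t where t: "z = g t" "0 \<le> t" "t \<le> d" by auto
    then have "t = 0 \<or> t \<in> {0<..e} \<or> t \<in> {e..d}" by auto
    then show "z \<in> {x}" using z t r e g0 by blast
  qed
  from pbox_dim_subset_singleton[OF r(1) this] show ?thesis by simp
qed

lemma theta_hat_Un:
  assumes "v \<in> sphere 0 1"
  shows "theta_hat x (A \<union> B) v = max (theta_hat x A v) (theta_hat x B v)"
proof (rule antisym)
  have "theta x (A \<union> B) v \<le> max (theta_hat x A v) (theta_hat x B v)"
    unfolding theta_def
  proof (rule SUP_least, clarify)
    fix d g assume g: "(d, g) \<in> probes x (A \<union> B) v"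
    have "pbox_dim x ((A \<union> B) \<inter> g ` {0..d})
        \<le> max (pbox_dim x (A \<inter> g ` {0..d})) (pbox_dim x (B \<inter> g ` {0..d}))"
      using pbox_dim_Un_le by (simp add: Int_Un_distrib2)
    also have "\<dots> \<le> max (theta_hat x A v) (theta_hat x B v)"
      using pbox_dim_probe_le_theta_hat[OF g assms] by (intro max.mono)
    finally show "pbox_dim x ((A \<union> B) \<inter> g ` {0..d}) \<le> max (theta_hat x A v) (theta_hat x B v)" .
  qed
  \<comment> \<open>\<open>theta_hat\<close> of the union is either \<open>theta\<close> or 0, so
    the bound on \<open>theta\<close> covers both cases.\<close>
  then show "theta_hat x (A \<union> B) v \<le> max (theta_hat x A v) (theta_hat x B v)"
    by (simp add: theta_hat_def)
qed (simp add: theta_hat_mono)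

text \<open>Suprema commute with binary maxima, here written as the lattice operation
  \<open>sup\<close>.\<close>

lemma proj_theta_hat_Un:
  "proj_theta_hat x (A \<union> B) \<xi> = max (proj_theta_hat x A \<xi>) (proj_theta_hat x B \<xi>)"
proof -
  have "proj_theta_hat x (A \<union> B) \<xi> =
      (SUP v\<in>{v \<in> sphere 0 1. proj_class v = \<xi>}. sup (theta_hat x A v) (theta_hat x B v))"
    unfolding proj_theta_hat_def by (intro SUP_cong) (auto simp: theta_hat_Un sup_max)
  also have "\<dots> = sup (proj_theta_hat x A \<xi>) (proj_theta_hat x B \<xi>)"
    unfolding proj_theta_hat_def by (rule complete_lattice_class.SUP_sup_distrib[symmetric])
  finally show ?thesis by (simp add: sup_max)
qed

text \<open>Unit representatives that are not effective contribute 0, the least value, and an empty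
  supremum is 0 as well. This carries the identity for extended weights over to
  \<open>cross_dim\<close>.\<close>

lemma proj_theta_hat_eq_proj_theta: "proj_theta_hat x E \<xi> = proj_theta x E \<xi>"
proof (rule antisym)
  show "proj_theta_hat x E \<xi> \<le> proj_theta x E \<xi>"
    unfolding proj_theta_hat_def proj_theta_def
    by (rule SUP_least) (auto simp: theta_hat_def intro: SUP_upper)
  show "proj_theta x E \<xi> \<le> proj_theta_hat x E \<xi>"
    unfolding proj_theta_hat_def proj_theta_def
    by (rule SUP_mono) (auto simp: theta_hat_def eff_dirs_def split: if_splits)
qed

theorem proposition4p14:
  fixes A B :: "(real^'n) set" and x :: "real^'n"
  assumes "x \<in> closure A \<inter> closure B"
  shows "proj_eff_dirs x (A \<union> B) = proj_eff_dirs x A \<union> proj_eff_dirs x B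
    \<and> (\<forall>\<xi>\<in>proj_space.
         proj_theta_hat x (A \<union> B) \<xi> = max (proj_theta_hat x A \<xi>) (proj_theta_hat x B \<xi>))
    \<and> cross_dim x (A \<union> B) =
        (SUP \<xi>s\<in>indep_families x (A \<union> B).
           \<Sum>i<length \<xi>s. max (proj_theta_hat x A (\<xi>s ! i)) (proj_theta_hat x B (\<xi>s ! i)))"
proof (intro conjI ballI)
  show "proj_eff_dirs x (A \<union> B) = proj_eff_dirs x A \<union> proj_eff_dirs x B"
    by (simp add: proj_eff_dirs_def eff_dirs_Un[OF assms] image_Un)
\<comment> \<open>Each summand of \<open>cross_dim\<close> is turned into an extended weight and
  then into the maximum; the families are unchanged.\<close>
qed (simp_all add: cross_dim_def proj_theta_hat_Un flip: proj_theta_hat_eq_proj_theta)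

end
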